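(* Let $p>1$ and $\alpha\ge 1-\frac{1}{2p}$. Then for every non-negative sequence $(\lambda_n)_{n\ge1}$ with $\lambda_1>0$ and every non-negative sequence $(x_n)_{n\ge1}$, $$\sum_{n=1}^{\infty}\lambda_n\left(\sum_{k=n}^{\infty}\Lambda_k^{\alpha}x_k\right)^p\le(\alpha p+1)^p\sum_{n=1}^{\infty}\lambda_n\Lambda_n^{\alpha p}\left(\sum_{k=n}^{\infty}x_k\right)^p,$$ where $\Lambda_n=\sum_{i=1}^n\lambda_i$.
   Context: All sequences are real. Sums of non-negative terms are taken in $[0,\infty]$, and any term of an outer sum with $\lambda_n=0$ is read as $0$. *)

theory Defs
  imports "HOL-Analysis.Analysis"
begin

(* Power of an extended non-negative real with a positive real exponent; infinity to the p is
   infinity.  For p <= 0 the value at infinity carries no meaning. *)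
definition ennreal_powr :: "ennreal \<Rightarrow> real \<Rightarrow> ennreal"  (infixr "powr\<^sub>\<infinity>" 80)
  where "x powr\<^sub>\<infinity> p = (if x = \<infinity> then \<infinity> else ennreal (enn2real x powr p))"

(* Sequences are indexed from 1; the value at index 0 is never used. *)
definition partial_sum :: "(nat \<Rightarrow> real) \<Rightarrow> nat \<Rightarrow> real"
  where "partial_sum l n = (\<Sum>i=1..n. l i)"

end

(* Argue by duality.  Write A_n and b_n for the tails of Lambda_k^alpha x_k and x_k, let
   q = p/(p-1) and g_n = A_n^(p-1).  Two summations by parts turn sum lambda_n g_n A_n into
   sum b_k (Lambda_k^alpha G_k - Lambda_(k-1)^alpha G_(k-1)), where G_k = sum_(i<=k) lambda_i g_i.
   Up to the factor lambda_k Lambda_k^alpha, the increment is at most g_k + alpha h_k, where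
   h_k = (Lambda_(k-1)/Lambda_k)^beta G_(k-1)/Lambda_(k-1) and beta = 1 - 1/(2p).  This exponent
   is large enough for the shifted averages h to satisfy Hardy's inequality
   ||h||_q <= p ||g||_q, so Hoelder's inequality gives the constant 1 + alpha p for finite
   sequences; monotone limits do the rest. *)
theory Submission
  imports Defs
begin

section \<open>Elementary inequalities for real powers, and Hoelder's inequality\<close>

text \<open>Convexity of t^q: its graph lies above its tangent at \<open>a\<close>. Young's
  inequality yields this without derivatives, so the endpoint 0 is covered as well.\<close>

lemma powr_tangent:
  fixes a b q :: real
  assumes "q > 1" "a \<ge> 0" "b \<ge> 0"
  shows "a powr q - b powr q \<le> q * (a powr q - a powr (q - 1) * b)"
proof -
  define p where "p = q / (q - 1)"
  have p: "p > 1" "1 / p + 1 / q = 1" "(q - 1) * p = q" "q / p = q - 1"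
    using assms by (auto simp: p_def field_simps)
  have "a powr (q - 1) * b \<le> (a powr (q - 1)) powr p / p + b powr q / q"
    using p assms by (intro Youngs_inequality) auto
  also have "(a powr (q - 1)) powr p = a powr q"
    by (simp add: powr_powr p)
  finally have "q * (a powr (q - 1) * b) \<le> q * (a powr q / p + b powr q / q)"
    using assms by (intro mult_left_mono) auto
  also have "\<dots> = (q - 1) * a powr q + b powr q"
    using assms by (simp add: distrib_left p flip: p(4))
  finally show ?thesis by (simp add: algebra_simps)
qed

text \<open>Meant for r = Lambda_(k-1)/Lambda_k. If \<alpha> > 1, Bernoulli's bound 1 - r^\<alpha>
  \<le> \<alpha> (1 - r) is multiplied by r \<le> r^\<beta>. Otherwise weighted AM-GM bounds
  r^(1-\<alpha>) - r by \<alpha> (1 - r), and r^\<alpha> \<le> r^\<beta> supplies the remaining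
  factor.\<close>

lemma Bernoulli_ratio_bound:
  fixes r \<alpha> \<beta> :: real
  assumes "0 \<le> r" "r \<le> 1" "0 < \<alpha>" "\<beta> \<le> 1" "\<beta> \<le> \<alpha>"
  shows "r * (1 - r powr \<alpha>) \<le> \<alpha> * (1 - r) * r powr \<beta>"
proof (cases "r = 0")
  case False
  then have r: "0 < r" using assms by simp
  show ?thesis
  proof (cases "\<alpha> > 1")
    case True
    have "1 - r powr \<alpha> \<le> \<alpha> * (1 - r)"
      using powr_tangent[of \<alpha> 1 r] True assms by simp
    moreover have "r \<le> r powr \<beta>"
      using powr_mono'[of \<beta> 1 r] assms by simp
    moreover have "0 \<le> 1 - r powr \<alpha>"
      using powr_le1[of \<alpha> r] assms by simp
    ultimately show ?thesis
      using mult_mono[of r "r powr \<beta>" "1 - r powr \<alpha>" "\<alpha> * (1 - r)"] assms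
      by (simp add: mult_ac)
  next
    case le: False
    have "1 powr \<alpha> * r powr (1 - \<alpha>) \<le> \<alpha> * 1 + (1 - \<alpha>) * r"
      using le assms r by (intro Youngs_inequality_0) auto
    then have "r powr (1 - \<alpha>) - r \<le> \<alpha> * (1 - r)"
      by (simp add: algebra_simps)
    moreover have "r powr \<alpha> \<le> r powr \<beta>"
      using assms by (intro powr_mono') auto
    ultimately have "r powr \<alpha> * (r powr (1 - \<alpha>) - r) \<le> r powr \<beta> * (\<alpha> * (1 - r))"
      using assms by (intro order_trans[OF mult_left_mono mult_right_mono]) auto
    moreover have "r powr \<alpha> * r powr (1 - \<alpha>) = r"
      using assms by (simp flip: powr_add)
    ultimately show ?thesis by (simp add: algebra_simps)
  qed
qed auto

text \<open>The exponent (q+1)/2 is the midpoint of 1 and q. Dividing by that power of r turns the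
  right-hand side into 2 sinh z with z = -(q-1)/2 * ln r, and 2 sinh z \<ge> 2z = -(q-1) ln r \<ge>
  (q-1)(1-r).\<close>

lemma midpoint_power_bound:
  fixes r q :: real
  assumes "0 \<le> r" "r \<le> 1" "q > 1"
  shows "(q - 1) * ((1 - r) * r powr ((q + 1) / 2)) \<le> r - r powr q"
proof (cases "r = 0")
  case False
  define z where "z = (q - 1) / 2 * (- ln r)"
  have r: "0 < r" "ln r \<le> 0" using assms False by auto
  have z: "0 \<le> z" unfolding z_def using assms r by (intro mult_nonneg_nonneg) auto
  have e: "exp (- z) = r powr ((q - 1) / 2)" "exp z = r powr (- (q - 1) / 2)"
    using r by (auto simp: z_def powr_def field_simps)
  have "(q - 1) * (1 - r) \<le> (q - 1) * (- ln r)"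
    using ln_le_minus_one[OF r(1)] assms by (intro mult_left_mono) auto
  also have "\<dots> = 2 * z" by (simp add: z_def algebra_simps)
  \<comment> \<open>The difference of the two sides vanishes at 0, and its derivative is a perfect
    square.\<close>
  also have "\<dots> \<le> exp z - exp (- z)"
  proof -
    have "exp 0 - exp (- 0) - 2 * 0 \<le> exp z - exp (- z) - 2 * z"
    proof (rule DERIV_nonneg_imp_nondecreasing[OF z])
      fix t :: real
      have "0 \<le> (exp (t / 2) - exp (- t / 2))\<^sup>2" by simp
      also have "\<dots> = exp t + exp (- t) - 2"
        by (simp add: power2_eq_square algebra_simps flip: exp_add)
      finally show "\<exists>y. ((\<lambda>z. exp z - exp (- z) - 2 * z) has_real_derivative y) (at t) \<and> 0 \<le> y"
        by (intro exI[of _ "exp t + exp (- t) - 2"]) (auto intro!: derivative_eq_intros)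
    qed
    then show ?thesis by simp
  qed
  finally have "(q - 1) * (1 - r) * r powr ((q + 1) / 2)
      \<le> (exp z - exp (- z)) * r powr ((q + 1) / 2)"
    by (intro mult_right_mono) auto
  also have "\<dots> = r powr (- (q - 1) / 2 + (q + 1) / 2) - r powr ((q - 1) / 2 + (q + 1) / 2)"
    by (simp only: e left_diff_distrib powr_add)
  also have "\<dots> = r powr 1 - r powr q"
    by (simp add: field_simps)
  finally show ?thesis using r by (simp add: mult.assoc)
qed auto

text \<open>Dividing f and g by their weighted norms and applying Young's inequality termwise bounds
  the normalised sum by 1/p + 1/q = 1. A zero norm forces every term on the left to vanish, so it is
  split off first.\<close>

lemma Hoelder_weighted_sum:
  fixes w f g :: "'a \<Rightarrow> real"
  assumes "p > 1" "q > 1" "1 / p + 1 / q = 1"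
    and w: "\<And>i. i \<in> S \<Longrightarrow> w i \<ge> 0" and f: "\<And>i. i \<in> S \<Longrightarrow> f i \<ge> 0" and g: "\<And>i. i \<in> S \<Longrightarrow> g i \<ge> 0"
  shows "(\<Sum>i\<in>S. w i * (f i * g i))
    \<le> (\<Sum>i\<in>S. w i * f i powr p) powr (1 / p) * (\<Sum>i\<in>S. w i * g i powr q) powr (1 / q)"
proof (cases "finite S")
  case True
  define F where "F = (\<Sum>i\<in>S. w i * f i powr p)"
  define G where "G = (\<Sum>i\<in>S. w i * g i powr q)"
  have nn: "F \<ge> 0" "G \<ge> 0" unfolding F_def G_def using w by (auto intro!: sum_nonneg)
  consider "F = 0" | "G = 0" | "F > 0" "G > 0" using nn by linarith
  then have "(\<Sum>i\<in>S. w i * (f i * g i)) \<le> F powr (1 / p) * G powr (1 / q)"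
  proof cases
    case 1
    then have "\<forall>i\<in>S. w i * f i powr p = 0"
      unfolding F_def using True w by (subst (asm) sum_nonneg_eq_0_iff) auto
    then have "(\<Sum>i\<in>S. w i * (f i * g i)) = 0" by (intro sum.neutral) auto
    then show ?thesis by simp
  next
    case 2
    then have "\<forall>i\<in>S. w i * g i powr q = 0"
      unfolding G_def using True w by (subst (asm) sum_nonneg_eq_0_iff) auto
    then have "(\<Sum>i\<in>S. w i * (f i * g i)) = 0" by (intro sum.neutral) auto
    then show ?thesis by simp
  next
    case 3
    define c where "c = F powr (1 / p)"
    define d where "d = G powr (1 / q)"
    have cd: "c > 0" "d > 0" "c powr p = F" "d powr q = G"
      using 3 assms by (auto simp: c_def d_def powr_powr)
    have "(\<Sum>i\<in>S. w i * (f i * g i)) = c * d * (\<Sum>i\<in>S. w i * ((f i / c) * (g i / d)))"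
      using cd by (simp add: sum_distrib_left field_simps)
    also have "\<dots> \<le> c * d * (\<Sum>i\<in>S. w i * ((f i / c) powr p / p + (g i / d) powr q / q))"
      using cd assms by (intro mult_left_mono sum_mono Youngs_inequality) auto
    also have "(\<Sum>i\<in>S. w i * ((f i / c) powr p / p + (g i / d) powr q / q))
       = (\<Sum>i\<in>S. w i * f i powr p) / (F * p) + (\<Sum>i\<in>S. w i * g i powr q) / (G * q)"
      using f g cd by (simp add: powr_divide distrib_left sum.distrib sum_divide_distrib mult_ac)
    also have "\<dots> = 1"
      using 3 assms by (simp flip: F_def G_def)
    finally show ?thesis by (simp add: c_def d_def)
  qed
  then show ?thesis by (simp add: F_def G_def)
qed simp

section \<open>Hardy's inequality for weighted averages\<close>

text \<open>The telescoping form of Hardy's inequality; both parts have the same right-hand side,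
  so the shifted averages inherit the bound for the ordinary ones.\<close>

lemma average_step:
  fixes p q :: real
  assumes pq: "p > 1" "q > 1" "1 / p + 1 / q = 1"
    and L: "L' \<ge> 0" "w \<ge> 0" "L = L' + w" "L > 0"
    and a: "a \<ge> 0" "a' \<ge> 0" "L * a = L' * a' + w * g"
  shows "w * a powr q - p * (w * (g * a powr (q - 1)))
      \<le> (p - 1) * (L' * a' powr q - L * a powr q)"
    and "w * ((L' / L) powr (1 - 1 / (2 * p)) * a') powr q - p * (w * (g * a powr (q - 1)))
      \<le> (p - 1) * (L' * a' powr q - L * a powr q)"
proof -
  define D where "D = a powr (q - 1)"
  define E where "E = a powr q"
  define E' where "E' = a' powr q"
  define r where "r = L' / L"
  have r: "0 \<le> r" "r \<le> 1" "L * r = L'" using L by (auto simp: r_def)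
  have p: "(p - 1) * q = p" "(p - 1) * (q - 1) = 1" using pq by (auto simp: field_simps)
  have Da: "D * a = E"
    using a by (cases "a = 0") (auto simp: D_def E_def powr_diff)
  have "L * a * D = (L' * a' + w * g) * D" by (simp only: a)
  \<comment> \<open>The recursion for the averages eliminates \<open>g\<close>, leaving only
    \<open>a\<close> and \<open>a'\<close>.\<close>
  then have g: "w * (g * D) = L * E - L' * a' * D" by (simp add: algebra_simps flip: Da)
  have "L' * (p - 1) * (E - E') \<le> L' * (p - 1) * (q * (E - D * a'))"
    unfolding D_def E_def E'_def
    using powr_tangent[of q a a'] a pq L by (intro mult_left_mono) auto
  also have "\<dots> = L' * ((p - 1) * q) * (E - D * a')" by simp
  also have "\<dots> = L' * p * (E - D * a')" by (simp only: p)
  finally have "w * E - p * (w * (g * D)) \<le> (p - 1) * (L' * E' - L * E)"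
    unfolding g L(3) by (simp add: algebra_simps)
  then show "w * a powr q - p * (w * (g * a powr (q - 1)))
      \<le> (p - 1) * (L' * a' powr q - L * a powr q)"
    by (simp add: D_def E_def E'_def)
  \<comment> \<open>The tangent inequality is now evaluated at \<open>r * a'\<close> instead of
    \<open>a'\<close>. Since \<open>L * r = L'\<close>, its right-hand side is exactly
    \<open>p * (w * (g * D))\<close>.\<close>
  have "L * (p - 1) * (E - r powr q * E') \<le> L * (p - 1) * (q * (E - D * (r * a')))"
    unfolding D_def E_def E'_def
    using powr_tangent[of q a "r * a'"] a pq L r
    by (intro mult_left_mono) (auto simp: powr_mult)
  also have "\<dots> = ((p - 1) * q) * (L * E - D * (L * r) * a')" by (simp add: algebra_simps)
  also have "\<dots> = p * (w * (g * D))" unfolding p r g by (simp add: algebra_simps)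
  finally have 1: "L * (p - 1) * (E - r powr q * E') \<le> p * (w * (g * D))" .
  have "(q + 1) / 2 = (1 - 1 / (2 * p)) * q"
    using pq p by (simp add: field_simps)
  then have "(r powr (1 - 1 / (2 * p)) * a') powr q = r powr ((q + 1) / 2) * E'"
    using r a by (simp add: powr_mult powr_powr E'_def)
  \<comment> \<open>The factor \<open>(p - 1) * (q - 1)\<close>, which equals 1, provides the
    \<open>q - 1\<close> that \<open>midpoint_power_bound\<close> asks for. The resulting term in
    \<open>r powr q * E'\<close> cancels the one in fact \<open>1\<close>.\<close>
  then have "w * (r powr (1 - 1 / (2 * p)) * a') powr q
      = L * (1 - r) * r powr ((q + 1) / 2) * E' * ((p - 1) * (q - 1))"
    using L r unfolding p by (simp add: algebra_simps)
  also have "\<dots> = L * (p - 1) * E' * ((q - 1) * ((1 - r) * r powr ((q + 1) / 2)))"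
    by (simp only: mult_ac)
  also have "\<dots> \<le> L * (p - 1) * E' * (r - r powr q)"
    using midpoint_power_bound[of r q] r pq L by (intro mult_left_mono) (auto simp: E'_def)
  also have "\<dots> = (p - 1) * ((L * r) * E') - L * (p - 1) * r powr q * E'"
    by (simp add: algebra_simps)
  finally have 2: "w * (r powr (1 - 1 / (2 * p)) * a') powr q
      \<le> (p - 1) * (L' * E') - L * (p - 1) * r powr q * E'" by (simp only: r)
  show "w * ((L' / L) powr (1 - 1 / (2 * p)) * a') powr q - p * (w * (g * a powr (q - 1)))
      \<le> (p - 1) * (L' * a' powr q - L * a powr q)"
    using 1 2 by (simp add: r_def D_def E_def E'_def algebra_simps)
qed

lemma partial_sum_0 [simp]: "partial_sum l 0 = 0"
  by (simp add: partial_sum_def)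

lemma partial_sum_Suc: "partial_sum l (Suc n) = partial_sum l n + l (Suc n)"
  by (simp add: partial_sum_def)

lemma partial_sum_nonneg:
  assumes "\<And>n. n \<ge> 1 \<Longrightarrow> l n \<ge> 0"
  shows "partial_sum l n \<ge> 0"
  using assms by (auto simp: partial_sum_def intro!: sum_nonneg)

lemma partial_sum_pos:
  assumes "\<And>n. n \<ge> 1 \<Longrightarrow> l n \<ge> 0" "l 1 > 0" "n \<ge> 1"
  shows "partial_sum l n > 0"
  unfolding partial_sum_def
  using assms by (intro sum_pos2[of _ 1]) auto

text \<open>Both sides add u_n v_k over 1 \<le> n \<le> k \<le> N. Read in either direction, this is
  the summation by parts of the duality argument.\<close>

lemma sum_partial_sum_swap:
  "(\<Sum>n=1..N. u n * (\<Sum>k=n..N. v k)) = (\<Sum>k=1..N. v k * partial_sum u k)"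
proof (induction N)
  case (Suc N)
  have "(\<Sum>n=1..N. u n * (\<Sum>k=n..Suc N. v k)) =
      (\<Sum>n=1..N. u n * (\<Sum>k=n..N. v k)) + v (Suc N) * partial_sum u N"
    by (simp add: partial_sum_def distrib_left sum.distrib sum_distrib_left mult.commute)
  then show ?case using Suc by (simp add: partial_sum_Suc algebra_simps)
qed simp

definition weighted_average :: "(nat \<Rightarrow> real) \<Rightarrow> (nat \<Rightarrow> real) \<Rightarrow> nat \<Rightarrow> real"
  where "weighted_average l g n = partial_sum (\<lambda>i. l i * g i) n / partial_sum l n"

text \<open>At \<open>n = 1\<close> both factors below vanish, since \<open>partial_sum l 0 = 0\<close> and \<open>0 / 0 = 0\<close>.\<close>

definition shifted_average :: "real \<Rightarrow> (nat \<Rightarrow> real) \<Rightarrow> (nat \<Rightarrow> real) \<Rightarrow> nat \<Rightarrow> real"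
  where "shifted_average \<beta> l g n =
    (partial_sum l (n - 1) / partial_sum l n) powr \<beta> * weighted_average l g (n - 1)"

lemma weighted_average_nonneg:
  assumes "\<And>n. n \<ge> 1 \<Longrightarrow> l n \<ge> 0" "\<And>n. n \<ge> 1 \<Longrightarrow> g n \<ge> 0"
  shows "weighted_average l g n \<ge> 0"
  unfolding weighted_average_def using assms
  by (intro divide_nonneg_nonneg partial_sum_nonneg) auto

text \<open>The bounds of \<open>average_step\<close> telescope: their right-hand sides are the
  differences of \<Phi>, which is 0 at index 0 and non-negative at N.\<close>

lemma average_sum_bounds:
  fixes p q :: real
  assumes pq: "p > 1" "q > 1" "1 / p + 1 / q = 1"
    and l: "\<And>n. n \<ge> 1 \<Longrightarrow> l n \<ge> 0" "l 1 > 0" and g: "\<And>n. n \<ge> 1 \<Longrightarrow> g n \<ge> 0"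
  defines "a \<equiv> weighted_average l g"
  shows "(\<Sum>n=1..N. l n * a n powr q) \<le> p * (\<Sum>n=1..N. l n * (g n * a n powr (q - 1)))"
    and "(\<Sum>n=1..N. l n * shifted_average (1 - 1 / (2 * p)) l g n powr q)
      \<le> p * (\<Sum>n=1..N. l n * (g n * a n powr (q - 1)))"
proof -
  let ?L = "partial_sum l"
  define \<Phi> where "\<Phi> n = (p - 1) * (?L n * a n powr q)" for n
  have a0: "a n \<ge> 0" for n unfolding a_def using l g by (intro weighted_average_nonneg) auto
  have L0: "?L n \<ge> 0" for n using l by (intro partial_sum_nonneg) auto
  have LS: "?L (Suc n) > 0" for n using l by (intro partial_sum_pos) auto
  \<comment> \<open>At index 0 both sides are 0, so the recursion \<open>step\<close> already holds
    for the first term.\<close>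
  have La: "?L n * a n = partial_sum (\<lambda>i. l i * g i) n" for n
    using LS by (cases n) (auto simp: a_def weighted_average_def less_imp_neq[symmetric])
  have step: "?L (Suc n) * a (Suc n) = ?L n * a n + l (Suc n) * g (Suc n)" for n
    unfolding La by (simp add: partial_sum_Suc)
  have telescope: "(\<Sum>n=1..N. u n) \<le> p * (\<Sum>n=1..N. l n * (g n * a n powr (q - 1)))"
    if *: "\<And>n. u (Suc n) - p * (l (Suc n) * (g (Suc n) * a (Suc n) powr (q - 1)))
        \<le> \<Phi> n - \<Phi> (Suc n)" for u
  proof -
    have "(\<Sum>n=1..N. u n) - p * (\<Sum>n=1..N. l n * (g n * a n powr (q - 1))) \<le> - \<Phi> N"
    proof (induction N)
      case (Suc N)
      then show ?case using *[of N] by (simp add: algebra_simps)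
    qed (simp add: \<Phi>_def)
    also have "- \<Phi> N \<le> 0" unfolding \<Phi>_def using pq L0 by simp
    finally show ?thesis by simp
  qed
  have "l (Suc n) \<ge> 0" for n using l by simp
  note st = average_step[OF pq L0 this partial_sum_Suc LS a0 a0 step]
  show "(\<Sum>n=1..N. l n * a n powr q) \<le> p * (\<Sum>n=1..N. l n * (g n * a n powr (q - 1)))"
    by (rule telescope) (use st(1) in \<open>simp add: \<Phi>_def right_diff_distrib\<close>)
  show "(\<Sum>n=1..N. l n * shifted_average (1 - 1 / (2 * p)) l g n powr q)
      \<le> p * (\<Sum>n=1..N. l n * (g n * a n powr (q - 1)))"
    by (rule telescope)
      (use st(2) in \<open>simp add: \<Phi>_def right_diff_distrib shifted_average_def flip: a_def\<close>)
qed

text \<open>Hoelder bounds the common right-hand side of \<open>average_sum_bounds\<close> by p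
  G^(1/q) I^(1/p). For the ordinary averages this is self-bounding and gives I^(1/q) \<le> p
  G^(1/q); inserting that into the bound for H gives the claim.\<close>

lemma Hardy_shifted_average:
  fixes p q :: real
  assumes pq: "p > 1" "q > 1" "1 / p + 1 / q = 1"
    and l: "\<And>n. n \<ge> 1 \<Longrightarrow> l n \<ge> 0" "l 1 > 0" and g: "\<And>n. n \<ge> 1 \<Longrightarrow> g n \<ge> 0"
  shows "(\<Sum>n=1..N. l n * shifted_average (1 - 1 / (2 * p)) l g n powr q) powr (1 / q)
    \<le> p * (\<Sum>n=1..N. l n * g n powr q) powr (1 / q)"
proof -
  define a where "a = weighted_average l g"
  define G where "G = (\<Sum>n=1..N. l n * g n powr q)"
  define I where "I = (\<Sum>n=1..N. l n * a n powr q)"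
  define H where "H = (\<Sum>n=1..N. l n * shifted_average (1 - 1 / (2 * p)) l g n powr q)"
  have nn: "G \<ge> 0" "I \<ge> 0" "H \<ge> 0"
    unfolding G_def I_def H_def using l by (auto intro!: sum_nonneg)
  have a0: "a n \<ge> 0" for n unfolding a_def using l g by (intro weighted_average_nonneg) auto
  have q: "(q - 1) * p = q" "1 / q + 1 / p = 1" "1 - 1 / p = 1 / q" "(q - 1) / q = 1 / p"
    using pq by (auto simp: field_simps)
  have "(\<Sum>n=1..N. l n * (g n * a n powr (q - 1)))
      \<le> (\<Sum>n=1..N. l n * g n powr q) powr (1 / q)
        * (\<Sum>n=1..N. l n * (a n powr (q - 1)) powr p) powr (1 / p)"
    using l g pq q by (intro Hoelder_weighted_sum) auto
  also have "\<dots> = G powr (1 / q) * I powr (1 / p)"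
    by (simp add: powr_powr q G_def I_def)
  finally have *: "p * (\<Sum>n=1..N. l n * (g n * a n powr (q - 1))) \<le> p * (G powr (1 / q) * I powr (1 / p))"
    using pq by simp
  note b = order_trans[OF average_sum_bounds(1)[where l = l and g = g and N = N, OF pq l g] *[unfolded a_def]]
    order_trans[OF average_sum_bounds(2)[where l = l and g = g and N = N, OF pq l g] *[unfolded a_def]]
  have I: "I \<le> p * (G powr (1 / q) * I powr (1 / p))"
    using b(1) by (simp add: I_def a_def)
  have H: "H \<le> p * (G powr (1 / q) * I powr (1 / p))"
    using b(2) by (simp add: H_def I_def a_def)
  have Iq: "I powr (1 / q) \<le> p * G powr (1 / q)"
  proof (cases "I = 0")
    case False
    then have "I > 0" using nn by simp
    then have "I powr (1 / q) = I / I powr (1 / p)"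
      by (simp flip: q(3) add: powr_diff)
    also have "\<dots> \<le> p * G powr (1 / q)"
      using I \<open>I > 0\<close> by (simp add: field_simps)
    finally show ?thesis .
  qed (use pq in auto)
  \<comment> \<open>As (q-1)/q = 1/p, the bound for I becomes a power of p G^(1/q), and the two
    factors combine to its q-th power.\<close>
  have "I powr (1 / p) = (I powr (1 / q)) powr (q - 1)"
    by (simp add: powr_powr q)
  also have "\<dots> \<le> (p * G powr (1 / q)) powr (q - 1)"
    using Iq pq by (intro powr_mono2) auto
  finally have "I powr (1 / p) \<le> (p * G powr (1 / q)) powr (q - 1)" .
  then have "p * G powr (1 / q) * I powr (1 / p)
      \<le> p * G powr (1 / q) * (p * G powr (1 / q)) powr (q - 1)"
    using pq by (intro mult_left_mono) auto
  also have "\<dots> = (p * G powr (1 / q)) powr q"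
  proof (cases "G = 0")
    case False
    then have "p * G powr (1 / q) > 0" using pq nn by auto
    then show ?thesis by (simp add: powr_diff)
  qed (use pq in auto)
  finally have "H \<le> (p * G powr (1 / q)) powr q"
    using H by (simp add: mult.assoc)
  then have "H powr (1 / q) \<le> ((p * G powr (1 / q)) powr q) powr (1 / q)"
    using nn pq by (intro powr_mono2) auto
  also have "\<dots> = p * G powr (1 / q)"
    using pq by (simp add: powr_powr)
  finally show ?thesis by (simp add: H_def G_def)
qed

section \<open>The inequality for finite sequences\<close>

text \<open>The increment splits into L_(n+1)^\<alpha> times the increment of G, which gives the
  term with g, and (L_(n+1)^\<alpha> - L_n^\<alpha>) G_n, which \<open>Bernoulli_ratio_bound\<close>
  controls.\<close>

lemma copson_increment_bound:
  fixes p \<alpha> :: real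
  assumes "p > 1" "\<alpha> \<ge> 1 - 1 / (2 * p)"
    and l: "\<And>n. n \<ge> 1 \<Longrightarrow> l n \<ge> 0" "l 1 > 0" and g: "\<And>n. n \<ge> 1 \<Longrightarrow> g n \<ge> 0"
  defines "L \<equiv> partial_sum l" and "G \<equiv> partial_sum (\<lambda>i. l i * g i)"
  shows "L (Suc n) powr \<alpha> * G (Suc n) - L n powr \<alpha> * G n
    \<le> l (Suc n) * (L (Suc n) powr \<alpha> *
         (g (Suc n) + \<alpha> * shifted_average (1 - 1 / (2 * p)) l g (Suc n)))"
proof -
  define \<beta> where "\<beta> = 1 - 1 / (2 * p)"
  \<comment> \<open>The lower bound on \<alpha> says precisely that \<beta> \<le> \<alpha>.\<close>
  have \<beta>: "\<beta> \<le> \<alpha>" "\<beta> \<le> 1" "\<beta> > 0" using assms by (auto simp: \<beta>_def field_simps)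
  define a where "a = weighted_average l g n"
  define r where "r = L n / L (Suc n)"
  have L0: "L n \<ge> 0" "L (Suc n) > 0"
    unfolding L_def using l by (auto intro!: partial_sum_nonneg partial_sum_pos)
  have LS: "L (Suc n) = L n + l (Suc n)" "G (Suc n) = G n + l (Suc n) * g (Suc n)"
    by (auto simp: L_def G_def partial_sum_Suc)
  have r: "0 \<le> r" "r \<le> 1" "L n = L (Suc n) * r" "l (Suc n) = L (Suc n) * (1 - r)"
    using L0 l(1)[of "Suc n"] LS by (auto simp: r_def field_simps)
  have a: "a \<ge> 0" unfolding a_def using l g by (intro weighted_average_nonneg) auto
  have G: "G n = L n * a"
  proof (cases n)
    case (Suc m)
    then have "L n > 0" unfolding L_def using l by (intro partial_sum_pos) auto
    then show ?thesis by (simp add: a_def weighted_average_def L_def G_def)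
  qed (simp add: G_def L_def)
  have sh: "shifted_average (1 - 1 / (2 * p)) l g (Suc n) = r powr \<beta> * a"
    by (simp add: shifted_average_def r_def \<beta>_def a_def L_def)
  have "L (Suc n) powr \<alpha> * G n - L n powr \<alpha> * G n
      = L (Suc n) powr \<alpha> * L (Suc n) * a * (r * (1 - r powr \<alpha>))"
    unfolding G using r L0 by (simp add: powr_mult algebra_simps)
  also have "\<dots> \<le> L (Suc n) powr \<alpha> * L (Suc n) * a * (\<alpha> * (1 - r) * r powr \<beta>)"
    using Bernoulli_ratio_bound[of r \<alpha> \<beta>] r \<beta> a L0 by (intro mult_left_mono) auto
  also have "\<dots> = l (Suc n) * (L (Suc n) powr \<alpha> * (\<alpha> * (r powr \<beta> * a)))"
    unfolding r(4) by (simp only: mult_ac)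
  finally show ?thesis unfolding sh LS(2) by (simp add: algebra_simps)
qed

text \<open>Cutting the tails off at N makes all quantities finite, so the self-bounding estimate I
  \<le> (\<alpha> p + 1) Y^(1/p) I^(1/q) may be divided by I^(1/q) when I is non-zero.\<close>

lemma copson_finite:
  fixes p \<alpha> :: real and l x :: "nat \<Rightarrow> real"
  assumes "p > 1" "\<alpha> \<ge> 1 - 1 / (2 * p)"
    and l: "\<And>n. n \<ge> 1 \<Longrightarrow> l n \<ge> 0" "l 1 > 0" and x: "\<And>n. n \<ge> 1 \<Longrightarrow> x n \<ge> 0"
  shows "(\<Sum>n=1..N. l n * (\<Sum>k=n..N. partial_sum l k powr \<alpha> * x k) powr p)
    \<le> (\<alpha> * p + 1) powr p *
      (\<Sum>n=1..N. l n * partial_sum l n powr (\<alpha> * p) * (\<Sum>k=n..N. x k) powr p)"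
proof -
  define q where "q = p / (p - 1)"
  have pq: "p > 1" "q > 1" "1 / p + 1 / q = 1" "(p - 1) * q = p" "1 - 1 / q = 1 / p"
    using assms by (auto simp: q_def field_simps)
  have \<alpha>: "\<alpha> > 0"
  proof -
    have "1 / (2 * p) < 1" using assms by simp
    then show ?thesis using assms by linarith
  qed
  define L where "L = partial_sum l"
  define A where "A n = (\<Sum>k=n..N. L k powr \<alpha> * x k)" for n
  define b where "b n = (\<Sum>k=n..N. x k)" for n
  \<comment> \<open>The extremal dual sequence: g_n A_n = A_n^p, and g_n^q = A_n^p because (p-1) q =
    p.\<close>
  define g where "g n = (if n \<ge> 1 then A n powr (p - 1) else 0)" for n
  define h where "h = shifted_average (1 - 1 / (2 * p)) l g"
  define y where "y n = L n powr \<alpha> * b n" for n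
  define G where "G = partial_sum (\<lambda>i. l i * g i)"
  define I where "I = (\<Sum>n=1..N. l n * A n powr p)"
  define Y where "Y = (\<Sum>n=1..N. l n * y n powr p)"
  have L0: "L n \<ge> 0" for n unfolding L_def using l by (intro partial_sum_nonneg) auto
  have A0: "A n \<ge> 0" if "n \<ge> 1" for n
    unfolding A_def using x that by (intro sum_nonneg) auto
  have b0: "b n \<ge> 0" if "n \<ge> 1" for n
    unfolding b_def using x that by (intro sum_nonneg) auto
  have g0: "g n \<ge> 0" for n by (simp add: g_def)
  have h0: "h n \<ge> 0" for n
    unfolding h_def shifted_average_def using l g0
    by (intro mult_nonneg_nonneg weighted_average_nonneg) auto
  have y0: "y n \<ge> 0" if "n \<ge> 1" for n using b0 that by (simp add: y_def)
  have nn: "I \<ge> 0" "Y \<ge> 0" unfolding I_def Y_def using l by (auto intro!: sum_nonneg)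
  have Agq: "(\<Sum>n=1..N. l n * g n powr q) = I"
    unfolding I_def by (intro sum.cong) (auto simp: g_def powr_powr pq)
  \<comment> \<open>Increments of L^\<alpha> G; their partial sums give it back because G vanishes
    at 0.\<close>
  define V where "V n = L n powr \<alpha> * G n - L (n - 1) powr \<alpha> * G (n - 1)" for n
  have PV: "partial_sum V k = L k powr \<alpha> * G k" for k
    by (induction k) (auto simp: partial_sum_Suc V_def G_def)
  have "I = (\<Sum>n=1..N. (l n * g n) * A n)"
    unfolding I_def
  proof (intro sum.cong refl)
    fix n assume "n \<in> {1..N}"
    then have "A n powr p = g n * A n"
      using A0[of n] by (cases "A n = 0") (auto simp: g_def powr_diff)
    then show "l n * A n powr p = l n * g n * A n" by simp
  qed
  also have "\<dots> = (\<Sum>k=1..N. x k * partial_sum V k)"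
    unfolding A_def sum_partial_sum_swap PV G_def[symmetric] by (simp only: mult_ac)
  \<comment> \<open>The first swap collected the weights into G; this one collects the x_k into the
    tails \<open>b\<close>, leaving the increments \<open>V\<close> as coefficients.\<close>
  also have "\<dots> = (\<Sum>n=1..N. V n * b n)"
    unfolding b_def by (rule sum_partial_sum_swap[symmetric])
  also have "\<dots> \<le> (\<Sum>n=1..N. (l n * (L n powr \<alpha> * (g n + \<alpha> * h n))) * b n)"
  proof (intro sum_mono mult_right_mono)
    fix n assume n: "n \<in> {1..N}"
    then show "b n \<ge> 0" by (intro b0) auto
    obtain m where m: "n = Suc m" using n by (cases n) auto
    show "V n \<le> l n * (L n powr \<alpha> * (g n + \<alpha> * h n))"
      using copson_increment_bound[where l = l and g = g and n = m, OF assms(1,2) l g0]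
      by (simp add: V_def m h_def L_def G_def)
  qed
  also have "\<dots> = (\<Sum>n=1..N. l n * (y n * g n)) + \<alpha> * (\<Sum>n=1..N. l n * (y n * h n))"
    by (simp add: y_def algebra_simps sum.distrib sum_distrib_left)
  \<comment> \<open>Hoelder handles both sums. The second also needs Hardy's inequality, whose
    factor p makes the total constant 1 + \<alpha> p.\<close>
  also have "\<dots> \<le> Y powr (1 / p) * I powr (1 / q) + \<alpha> * (Y powr (1 / p) * (p * I powr (1 / q)))"
  proof (intro add_mono mult_left_mono)
    show "(\<Sum>n=1..N. l n * (y n * g n)) \<le> Y powr (1 / p) * I powr (1 / q)"
      using Hoelder_weighted_sum[OF pq(1-3), of "{1..N}" l y g] l y0 g0 Agq by (simp add: Y_def)
    have "(\<Sum>n=1..N. l n * (y n * h n))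
        \<le> Y powr (1 / p) * (\<Sum>n=1..N. l n * h n powr q) powr (1 / q)"
      using Hoelder_weighted_sum[OF pq(1-3), of "{1..N}" l y h] l y0 h0 by (simp add: Y_def)
    also have "\<dots> \<le> Y powr (1 / p) * (p * I powr (1 / q))"
      using Hardy_shifted_average[where l = l and g = g and N = N, OF pq(1-3) l g0] by (intro mult_left_mono) (simp_all add: h_def flip: Agq)
    finally show "(\<Sum>n=1..N. l n * (y n * h n)) \<le> Y powr (1 / p) * (p * I powr (1 / q))" .
  qed (use \<alpha> in auto)
  finally have I: "I \<le> (\<alpha> * p + 1) * Y powr (1 / p) * I powr (1 / q)"
    by (simp add: algebra_simps)
  have C: "\<alpha> * p + 1 > 0" using \<alpha> pq by (simp add: add_pos_pos)
  have "I powr (1 / p) \<le> (\<alpha> * p + 1) * Y powr (1 / p)"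
  proof (cases "I = 0")
    case False
    then have "I > 0" using nn by simp
    then have "I powr (1 / p) = I / I powr (1 / q)"
      by (simp flip: pq(5) add: powr_diff)
    also have "\<dots> \<le> (\<alpha> * p + 1) * Y powr (1 / p)"
      using I \<open>I > 0\<close> by (simp add: field_simps)
    finally show ?thesis .
  qed (use C in auto)
  then have "(I powr (1 / p)) powr p \<le> ((\<alpha> * p + 1) * Y powr (1 / p)) powr p"
    using pq by (intro powr_mono2) auto
  then have "I \<le> (\<alpha> * p + 1) powr p * Y"
    using nn C pq by (simp add: powr_mult powr_powr)
  moreover have "Y = (\<Sum>n=1..N. l n * L n powr (\<alpha> * p) * b n powr p)"
    unfolding Y_def by (intro sum.cong) (use b0 in \<open>auto simp: y_def powr_mult powr_powr mult.assoc\<close>)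
  ultimately show ?thesis by (simp add: I_def A_def b_def L_def)
qed

section \<open>Passage to the limit\<close>

lemma ennreal_powr_mono:
  assumes "x \<le> y" "p \<ge> 0"
  shows "x powr\<^sub>\<infinity> p \<le> y powr\<^sub>\<infinity> p"
proof (cases "y = \<infinity>")
  case False
  then have "x \<noteq> \<infinity>" "y < \<infinity>" using assms by (auto simp: top_unique less_top)
  then show ?thesis using assms False
    by (auto simp: ennreal_powr_def intro!: ennreal_leI powr_mono2 enn2real_mono)
qed (simp add: ennreal_powr_def)

lemma ennreal_powr_ennreal:
  "x \<ge> 0 \<Longrightarrow> ennreal x powr\<^sub>\<infinity> p = ennreal (x powr p)"
  by (simp add: ennreal_powr_def)

text \<open>A finite limit reduces to continuity of the real power; for an infinite one, s^p = exp
  (p ln s) is a composition of maps tending to infinity.\<close>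

lemma tendsto_ennreal_powr:
  assumes lim: "(\<lambda>n. ennreal (s n)) \<longlonglongrightarrow> S" and s: "\<And>n. s n \<ge> 0" and p: "p > 0"
  shows "(\<lambda>n. ennreal (s n) powr\<^sub>\<infinity> p) \<longlonglongrightarrow> S powr\<^sub>\<infinity> p"
proof (cases S)
  case (real r)
  then have "s \<longlonglongrightarrow> r" using lim s by (simp add: tendsto_ennreal_iff)
  then have "(\<lambda>n. s n powr p) \<longlonglongrightarrow> r powr p"
    using s p by (intro tendsto_powr') auto
  then show ?thesis using real s by (simp add: ennreal_powr_ennreal)
next
  case top
  then have "filterlim s at_top sequentially"
    using lim by (simp add: ennreal_tendsto_top_eq_at_top)
  then have "filterlim (\<lambda>n. exp (p * ln (s n))) at_top sequentially"
    by (intro filterlim_compose[OF exp_at_top] filterlim_tendsto_pos_mult_at_top[OF tendsto_const p]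
        filterlim_compose[OF ln_at_top])
  \<comment> \<open>\<open>powr\<close> treats base 0 separately, so the formula is used once
    \<open>s n > 0\<close>.\<close>
  moreover have "\<forall>\<^sub>F n in sequentially. exp (p * ln (s n)) = s n powr p"
    using filterlim_at_top_dense[THEN iffD1, rule_format, OF \<open>filterlim s at_top sequentially\<close>, of 0]
    by eventually_elim (simp add: powr_def)
  ultimately have "filterlim (\<lambda>n. s n powr p) at_top sequentially"
    by (simp add: filterlim_cong[OF refl refl])
  then have "(\<lambda>n. ennreal (s n powr p)) \<longlonglongrightarrow> \<infinity>"
    by (simp add: ennreal_tendsto_top_eq_at_top)
  then show ?thesis using top s by (simp add: ennreal_powr_ennreal) (simp add: ennreal_powr_def)
qed

text \<open>The intervals \<open>{n..N}\<close> eventually contain every finite subset of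
  \<open>{n..}\<close>, so they run along the filter defining the unordered sum.\<close>

lemma tail_sums_tendsto_infsum:
  fixes f :: "nat \<Rightarrow> ennreal"
  shows "(\<lambda>N. \<Sum>k=n..N. f k) \<longlonglongrightarrow> (\<Sum>\<^sub>\<infinity>k\<in>{n..}. f k)"
proof -
  have "(f has_sum (\<Sum>\<^sub>\<infinity>k\<in>{n..}. f k)) {n..}"
    by (intro has_sum_infsum nonneg_summable_on_complete) auto
  moreover have "filterlim (\<lambda>N. {n..N}) (finite_subsets_at_top {n..}) sequentially"
    unfolding filterlim_finite_subsets_at_top
  proof (intro allI impI)
    fix X assume X: "finite X \<and> X \<subseteq> {n..}"
    show "\<forall>\<^sub>F N in sequentially. finite {n..N} \<and> X \<subseteq> {n..N} \<and> {n..N} \<subseteq> {n..}"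
      using eventually_ge_at_top[of "Max X"]
      by eventually_elim (use X in \<open>auto intro: order_trans[OF Max_ge]\<close>)
  qed
  ultimately show ?thesis
    unfolding has_sum_def by (rule filterlim_compose)
qed

lemma finite_sum_le_infsum_ennreal:
  fixes f :: "'a \<Rightarrow> ennreal"
  assumes "finite F" "F \<subseteq> A"
  shows "sum f F \<le> infsum f A"
  using assms by (subst nonneg_infsum_complete) (auto intro!: SUP_upper)

theorem theorem3p1:
  fixes p \<alpha> :: real and l x :: "nat \<Rightarrow> real"
  assumes "p > 1" and "\<alpha> \<ge> 1 - 1 / (2 * p)"
    and "\<And>n. n \<ge> 1 \<Longrightarrow> l n \<ge> 0" and "l 1 > 0"
    and "\<And>n. n \<ge> 1 \<Longrightarrow> x n \<ge> 0"
  shows "(\<Sum>\<^sub>\<infinity>n\<in>{1..}. ennreal (l n) *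
            (\<Sum>\<^sub>\<infinity>k\<in>{n..}. ennreal (partial_sum l k powr \<alpha> * x k)) powr\<^sub>\<infinity> p)
         \<le> ennreal ((\<alpha> * p + 1) powr p) *
            (\<Sum>\<^sub>\<infinity>n\<in>{1..}. ennreal (l n * partial_sum l n powr (\<alpha> * p)) *
              (\<Sum>\<^sub>\<infinity>k\<in>{n..}. ennreal (x k)) powr\<^sub>\<infinity> p)"
    (is "_ \<le> ?C * ?R")
proof -
  note l = assms(3,4) and x = assms(5)
  define A where "A N n = (if n \<ge> 1 then \<Sum>k=n..N. partial_sum l k powr \<alpha> * x k else 0)" for N n
  have A0: "A N n \<ge> 0" for N n
    unfolding A_def using x by (auto intro!: sum_nonneg)
  have Alim: "(\<lambda>N. ennreal (A N n)) \<longlonglongrightarrow> (\<Sum>\<^sub>\<infinity>k\<in>{n..}. ennreal (partial_sum l k powr \<alpha> * x k))"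
    if "n \<ge> 1" for n
  proof -
    have "ennreal (A N n) = (\<Sum>k=n..N. ennreal (partial_sum l k powr \<alpha> * x k))" for N
      unfolding A_def using that x by (subst sum_ennreal) auto
    then show ?thesis by (simp only: tail_sums_tendsto_infsum)
  qed
  \<comment> \<open>A bound uniform in N: after the finite inequality, only the right-hand side is
    enlarged to full tails and the full outer sum.\<close>
  have fin: "(\<Sum>n=1..N. ennreal (l n) * ennreal (A N n) powr\<^sub>\<infinity> p) \<le> ?C * ?R" for N
  proof -
    have b0: "(\<Sum>k=n..N. x k) \<ge> 0" if "n \<ge> 1" for n using x that by (intro sum_nonneg) auto
    have "(\<Sum>n=1..N. ennreal (l n) * ennreal (A N n) powr\<^sub>\<infinity> p)
        = (\<Sum>n=1..N. ennreal (l n * A N n powr p))"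
      using A0 l by (intro sum.cong) (auto simp: ennreal_powr_ennreal ennreal_mult)
    also have "\<dots> = ennreal (\<Sum>n=1..N. l n * A N n powr p)"
      using l by (intro sum_ennreal) auto
    also have "\<dots> \<le> ennreal ((\<alpha> * p + 1) powr p *
      (\<Sum>n=1..N. l n * partial_sum l n powr (\<alpha> * p) * (\<Sum>k=n..N. x k) powr p))"
      using copson_finite[of p \<alpha> l x N] assms by (intro ennreal_leI) (simp add: A_def)
    also have "\<dots> = ?C * ennreal (\<Sum>n=1..N. l n * partial_sum l n powr (\<alpha> * p) * (\<Sum>k=n..N. x k) powr p)"
      using l by (intro ennreal_mult sum_nonneg) auto
    also have "ennreal (\<Sum>n=1..N. l n * partial_sum l n powr (\<alpha> * p) * (\<Sum>k=n..N. x k) powr p)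
        = (\<Sum>n=1..N. ennreal (l n * partial_sum l n powr (\<alpha> * p) * (\<Sum>k=n..N. x k) powr p))"
      using l by (intro sum_ennreal[symmetric]) auto
    also have "\<dots> = (\<Sum>n=1..N. ennreal (l n * partial_sum l n powr (\<alpha> * p)) *
                (\<Sum>k=n..N. ennreal (x k)) powr\<^sub>\<infinity> p)"
    proof (intro sum.cong refl)
      fix n assume n: "n \<in> {1..N}"
      then have "(\<Sum>k=n..N. ennreal (x k)) = ennreal (\<Sum>k=n..N. x k)"
        using x by (intro sum_ennreal) auto
      then show "ennreal (l n * partial_sum l n powr (\<alpha> * p) * (\<Sum>k=n..N. x k) powr p)
        = ennreal (l n * partial_sum l n powr (\<alpha> * p)) * (\<Sum>k=n..N. ennreal (x k)) powr\<^sub>\<infinity> p"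
        using n l b0[of n] by (simp add: ennreal_powr_ennreal flip: ennreal_mult)
    qed
    also have "\<dots> \<le> (\<Sum>n=1..N. ennreal (l n * partial_sum l n powr (\<alpha> * p)) *
                (\<Sum>\<^sub>\<infinity>k\<in>{n..}. ennreal (x k)) powr\<^sub>\<infinity> p)"
      using assms by (intro sum_mono mult_left_mono ennreal_powr_mono finite_sum_le_infsum_ennreal) auto
    also have "\<dots> \<le> ?R"
      by (intro finite_sum_le_infsum_ennreal) auto
    finally show ?thesis by (simp add: mult_left_mono)
  qed
  show ?thesis
  \<comment> \<open>The outer sum is a supremum over finite sets \<open>F\<close>, so the inner
    limit is taken under a finite sum.\<close>
  proof (subst nonneg_infsum_complete, simp, intro SUP_least)
    fix F :: "nat set" assume "F \<in> {F. finite F \<and> F \<subseteq> {1..}}"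
    then have F: "finite F" "F \<subseteq> {1..}" by auto
    \<comment> \<open>Multiplication by the finite weight \<open>ennreal (l n)\<close> preserves
      limits, even for weight 0 and an infinite inner limit, as 0 times infinity is 0.\<close>
    have "(\<lambda>N. \<Sum>n\<in>F. ennreal (l n) * ennreal (A N n) powr\<^sub>\<infinity> p) \<longlonglongrightarrow>
      (\<Sum>n\<in>F. ennreal (l n) *
            (\<Sum>\<^sub>\<infinity>k\<in>{n..}. ennreal (partial_sum l k powr \<alpha> * x k)) powr\<^sub>\<infinity> p)"
      using F A0 assms(1)
      by (intro tendsto_sum ennreal_tendsto_cmult tendsto_ennreal_powr Alim) auto
    \<comment> \<open>From N = \<open>Max F\<close> on, \<open>F\<close> lies inside
      \<open>{1..N}\<close> and \<open>fin\<close> applies.\<close>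
    moreover have "\<exists>M. \<forall>N\<ge>M. (\<Sum>n\<in>F. ennreal (l n) * ennreal (A N n) powr\<^sub>\<infinity> p) \<le> ?C * ?R"
    proof (intro exI allI impI)
      fix N assume N: "Max F \<le> N"
      have "(\<Sum>n\<in>F. ennreal (l n) * ennreal (A N n) powr\<^sub>\<infinity> p)
          \<le> (\<Sum>n=1..N. ennreal (l n) * ennreal (A N n) powr\<^sub>\<infinity> p)"
        using F N by (intro sum_mono2) (auto intro: order_trans[OF Max_ge])
      also note fin
      finally show "(\<Sum>n\<in>F. ennreal (l n) * ennreal (A N n) powr\<^sub>\<infinity> p) \<le> ?C * ?R" .
    qed
    ultimately show "(\<Sum>n\<in>F. ennreal (l n) *
            (\<Sum>\<^sub>\<infinity>k\<in>{n..}. ennreal (partial_sum l k powr \<alpha> * x k)) powr\<^sub>\<infinity> p) \<le> ?C * ?R"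
      by (rule LIMSEQ_le_const2)
  qed
qed

end
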